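(* Let $T$ be a compact metric space, let $t\mapsto a_t\in\mathbb{R}^n$ be a continuous function on $T$, and let $\mathcal{F}:C(T,\mathbb{R})\rightrightarrows\mathbb{R}^n$ be the multifunction $\mathcal{F}(b)=\{x\in\mathbb{R}^n\mid a_t'x\leq b_t,\ t\in T\}$. Let $\overline{b}\in\operatorname{dom}\mathcal{F}$ and assume that the system $\sigma(\overline{b})=\{a_t'x\leq\overline{b}_t,\ t\in T\}$ is locally polyhedral. Then $$\operatorname{Hof}\mathcal{F}(\overline{b})=\sup_{x\in\mathcal{E}(\overline{b})}\operatorname{clm}\mathcal{F}(\overline{b},x)=\sup_{x\in\mathcal{E}(\overline{b})}\ \sup_{D\in\mathcal{D}(x)}d_*\bigl(0_n,\operatorname{conv}\{a_t,\ t\in D\}\bigr)^{-1}.$$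
   Context: $x'y$ is the usual inner product in $\mathbb{R}^n$ and $0_n$ is the zero vector. $\mathbb{R}^n$ is equipped with an arbitrary norm $\|\cdot\|$, with dual norm $\|u\|_*=\max_{\|x\|\leq1}|u'x|$; $d$ is the distance on $\mathbb{R}^n$ induced by $\|\cdot\|$ and $d_*$ the distance induced by $\|\cdot\|_*$. $C(T,\mathbb{R})$ is the space of continuous functions $b=(b_t)_{t\in T}$ from $T$ to $\mathbb{R}$ with the supremum norm $\|b\|_\infty=\max_{t\in T}|b_t|$, whose distance is also denoted by $d$. The distance from a point to $\emptyset$ is $+\infty$, $(+\infty)^{-1}=0$, and $\sup\emptyset=0$. $\operatorname{dom}\mathcal{F}=\{b\mid\mathcal{F}(b)\neq\emptyset\}$ and $\mathcal{F}^{-1}(x)=\{b\mid x\in\mathcal{F}(b)\}$. The Hoffman modulus $\operatorname{Hof}\mathcal{F}(\overline{b})\in[0,+\infty]$ is the infimum of all $\kappa\geq0$ such that $d(x,\mathcal{F}(\overline{b}))\leq\kappa\, d(\overline{b},\mathcal{F}^{-1}(x))$ for all $x\in\mathbb{R}^n$. For $\overline{x}\in\mathcal{F}(\overline{b})$, the calmness modulus $\operatorname{clm}\mathcal{F}(\overline{b},\overline{x})\in[0,+\infty]$ is the infimum of all $\kappa\geq0$ for which there is a neighborhood $U$ of $\overline{x}$ such that $d(x,\mathcal{F}(\overline{b}))\leq\kappa\, d(\overline{b},\mathcal{F}^{-1}(x))$ for all $x\in U$. (Both are $+\infty$ if no such $\kappa$ exists.) For $x\in\mathcal{F}(\overline{b})$: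 $T(x)=\{t\in T\mid a_t'x=\overline{b}_t\}$ is the set of active indices; $A(x)=\operatorname{cone}\{a_t,\ t\in T(x)\}$ is the active cone, where $\operatorname{cone}$ denotes the conical convex hull, always containing $0_n$ (so $\operatorname{cone}\emptyset=\{0_n\}$); and $\mathcal{D}(x)$ is the family of all subsets $D\subset T(x)$ for which there exists $d\in\mathbb{R}^n$ with $a_t'd=1$ for all $t\in D$ and $a_t'd<1$ for all $t\in T(x)\setminus D$. The negative polar of $S\subset\mathbb{R}^n$ is $S^\circ=\{u\in\mathbb{R}^n\mid u'x\leq0\ \text{for all }x\in S\}$. The system $\sigma(\overline{b})$ is locally polyhedral (LOP) if $D(\mathcal{F}(\overline{b}),\overline{x})=A(\overline{x})^\circ$ for all $\overline{x}\in\mathcal{F}(\overline{b})$, where $D(\mathcal{F}(\overline{b}),\overline{x})$ is the cone of feasible directions, i.e. the set of $d\in\mathbb{R}^n$ for which there is $\varepsilon>0$ with $\overline{x}+\alpha d\in\mathcal{F}(\overline{b})$ for all $\alpha\in[0,\varepsilon]$. Finally, $\mathcal{E}(\overline{b})=\operatorname{extr}\bigl(\mathcal{F}(\overline{b})\cap\operatorname{span}\{a_t,\ t\in T\}\bigr)$, where $\operatorname{extr}$ denotes the set of extreme points, $\operatorname{span}$ the linear hull, and $\operatorname{conv}$ the convex hull. *)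

theory Defs
  imports "HOL-Analysis.Analysis"
begin

section \<open>Norms and distances\<close>

definition is_norm :: "(real ^ 'n \<Rightarrow> real) \<Rightarrow> bool"
  where "is_norm N \<longleftrightarrow>
    (\<forall>x. N x = 0 \<longleftrightarrow> x = 0) \<and>
    (\<forall>c x. N (c *\<^sub>R x) = \<bar>c\<bar> * N x) \<and>
    (\<forall>x y. N (x + y) \<le> N x + N y)"

definition dual_norm :: "(real ^ 'n \<Rightarrow> real) \<Rightarrow> real ^ 'n \<Rightarrow> real"
  where "dual_norm N u = (SUP x\<in>{x. N x \<le> 1}. \<bar>u \<bullet> x\<bar>)"

definition norm_dist :: "(real ^ 'n \<Rightarrow> real) \<Rightarrow> real ^ 'n \<Rightarrow> real ^ 'n \<Rightarrow> real"
  where "norm_dist N x y = N (x - y)"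

text \<open>Values are in \<^typ>\<open>ennreal\<close>, since the distance to the empty set is infinite
  (the library's \<^const>\<open>infdist\<close> and \<^const>\<open>setdist\<close> give 0 there). In
  \<^typ>\<open>ennreal\<close> also \<^prop>\<open>inverse (\<infinity>::ennreal) = 0\<close> and
  \<^prop>\<open>Sup {} = (0::ennreal)\<close> hold.\<close>

definition dist_to_set :: "('a \<Rightarrow> 'a \<Rightarrow> real) \<Rightarrow> 'a \<Rightarrow> 'a set \<Rightarrow> ennreal"
  where "dist_to_set \<delta> x S = (INF y\<in>S. ennreal (\<delta> x y))"

section \<open>Multifunctions\<close>

definition mf_dom :: "('b \<Rightarrow> 'a set) \<Rightarrow> 'b set"
  where "mf_dom F = {b. F b \<noteq> {}}"

definition mf_inverse :: "('b \<Rightarrow> 'a set) \<Rightarrow> 'a \<Rightarrow> 'b set"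
  where "mf_inverse F x = {b. x \<in> F b}"

definition Hof :: "(real ^ 'n \<Rightarrow> real) \<Rightarrow> ('b::metric_space \<Rightarrow> (real ^ 'n) set) \<Rightarrow> 'b \<Rightarrow> ennreal"
  where "Hof N F b = Inf {ennreal \<kappa> | \<kappa>. \<kappa> \<ge> 0 \<and>
    (\<forall>x. dist_to_set (norm_dist N) x (F b)
          \<le> ennreal \<kappa> * dist_to_set dist b (mf_inverse F x))}"

text \<open>Neighbourhoods are taken in the standard topology, which is the one induced by every
  norm on a finite-dimensional space.\<close>

definition clm ::
    "(real ^ 'n \<Rightarrow> real) \<Rightarrow> ('b::metric_space \<Rightarrow> (real ^ 'n) set) \<Rightarrow> 'b \<Rightarrow> real ^ 'n \<Rightarrow> ennreal"
  where "clm N F b xbar = Inf {ennreal \<kappa> | \<kappa>. \<kappa> \<ge> 0 \<and>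
    (\<forall>\<^sub>F x in nhds xbar. dist_to_set (norm_dist N) x (F b)
          \<le> ennreal \<kappa> * dist_to_set dist b (mf_inverse F x))}"

section \<open>Linear inequality systems\<close>

text \<open>For compact \<open>'t\<close>, the type \<open>'t \<Rightarrow>\<^sub>C real\<close> consists of all continuous functions, and its
  metric is the supremum distance.\<close>

definition feasible :: "('t::metric_space \<Rightarrow> real ^ 'n) \<Rightarrow> ('t \<Rightarrow>\<^sub>C real) \<Rightarrow> (real ^ 'n) set"
  where "feasible a b = {x. \<forall>t. a t \<bullet> x \<le> apply_bcontfun b t}"

definition active_set :: "('t::metric_space \<Rightarrow> real ^ 'n) \<Rightarrow> ('t \<Rightarrow>\<^sub>C real) \<Rightarrow> real ^ 'n \<Rightarrow> 't set"
  where "active_set a b x = {t. a t \<bullet> x = apply_bcontfun b t}"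

text \<open>\<^term>\<open>convex_cone hull S\<close> always contains 0, also for empty \<open>S\<close>.\<close>

definition active_cone ::
    "('t::metric_space \<Rightarrow> real ^ 'n) \<Rightarrow> ('t \<Rightarrow>\<^sub>C real) \<Rightarrow> real ^ 'n \<Rightarrow> (real ^ 'n) set"
  where "active_cone a b x = convex_cone hull (a ` active_set a b x)"

definition supported_subsets ::
    "('t::metric_space \<Rightarrow> real ^ 'n) \<Rightarrow> ('t \<Rightarrow>\<^sub>C real) \<Rightarrow> real ^ 'n \<Rightarrow> 't set set"
  where "supported_subsets a b x = {D. D \<subseteq> active_set a b x \<and>
    (\<exists>d. (\<forall>t\<in>D. a t \<bullet> d = 1) \<and> (\<forall>t\<in>active_set a b x - D. a t \<bullet> d < 1))}"

definition neg_polar :: "(real ^ 'n) set \<Rightarrow> (real ^ 'n) set"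
  where "neg_polar S = {u. \<forall>x\<in>S. u \<bullet> x \<le> 0}"

definition feasible_directions :: "(real ^ 'n) set \<Rightarrow> real ^ 'n \<Rightarrow> (real ^ 'n) set"
  where "feasible_directions S x =
    {d. \<exists>\<epsilon>>0. \<forall>\<alpha>\<in>{0..\<epsilon>}. x + \<alpha> *\<^sub>R d \<in> S}"

definition locally_polyhedral :: "('t::metric_space \<Rightarrow> real ^ 'n) \<Rightarrow> ('t \<Rightarrow>\<^sub>C real) \<Rightarrow> bool"
  where "locally_polyhedral a b \<longleftrightarrow>
    (\<forall>x\<in>feasible a b. feasible_directions (feasible a b) x = neg_polar (active_cone a b x))"

definition extreme_points :: "('t::metric_space \<Rightarrow> real ^ 'n) \<Rightarrow> ('t \<Rightarrow>\<^sub>C real) \<Rightarrow> (real ^ 'n) set"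
  where "extreme_points a b = {x. x extreme_point_of (feasible a b \<inter> span (range a))}"

end

theory Submission
  imports Defs
begin

text \<open>Upper bound for the Hoffman modulus: let \<open>y\<close> be a point of the feasible set \<open>F\<close> nearest
  to \<open>x\<close>. Separating \<open>F\<close> from the open ball around \<open>x\<close> gives a normal \<open>u\<close> to \<open>F\<close> at \<open>y\<close> with
  \<open>u \<bullet> (x - y) = dual_norm N u * N (x - y)\<close>. The face of \<open>F \<inter> span (range a)\<close> on which \<open>u\<close>
  is maximal contains no line, so it has an extreme point \<open>e\<close>, and \<open>u \<bullet> (x - e) = u \<bullet> (x - y)\<close>.
  Local polyhedrality puts \<open>u\<close> into the closure of the active cone at \<open>e\<close>, where \<open>u \<bullet> (x - e)\<close>
  is controlled by the largest violation at \<open>x\<close> and the faces of \<open>conv {a\<^sub>t}\<close> for \<open>t\<close> active at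
  \<open>e\<close>. Lower bound for the calmness modulus: if \<open>d\<close> exposes \<open>D\<close> at \<open>e\<close>, move from \<open>e\<close> in the
  direction \<open>d\<close>; every point of \<open>conv {a\<^sub>t, t \<in> D}\<close> is a normal to \<open>F\<close> at \<open>e\<close>.\<close>

section \<open>Norms and dual norms\<close>

lemma
  assumes "is_norm N"
  shows is_norm_eq_0: "N x = 0 \<longleftrightarrow> x = 0"
    and is_norm_scale: "N (c *\<^sub>R x) = \<bar>c\<bar> * N x"
    and is_norm_triangle: "N (x + y) \<le> N x + N y"
  using assms unfolding is_norm_def by blast+

lemma is_norm_minus: "is_norm N \<Longrightarrow> N (- x) = N x"
  using is_norm_scale[of N "-1" x] by simp

lemma is_norm_nonneg:
  assumes "is_norm N"
  shows "0 \<le> N x"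
proof -
  have "N (x + (- x)) \<le> N x + N (- x)"
    by (rule is_norm_triangle[OF assms])
  then show ?thesis
    using is_norm_eq_0[OF assms, of 0] is_norm_minus[OF assms, of x] by simp
qed

text \<open>Serves to obtain continuity of \<open>N\<close>: a finite convex function on all of R^n
  is continuous.\<close>

lemma convex_on_is_norm:
  assumes "is_norm N"
  shows "convex_on UNIV N"
proof (rule convex_onI)
  fix t :: real and x y assume t: "0 < t" "t < 1"
  have "N ((1 - t) *\<^sub>R x + t *\<^sub>R y) \<le> N ((1 - t) *\<^sub>R x) + N (t *\<^sub>R y)"
    by (rule is_norm_triangle[OF assms])
  then show "N ((1 - t) *\<^sub>R x + t *\<^sub>R y) \<le> (1 - t) * N x + t * N y"
    using t by (simp add: is_norm_scale[OF assms])
qed simp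

lemma continuous_on_is_norm: "is_norm N \<Longrightarrow> continuous_on S N"
  using convex_on_continuous[OF open_UNIV convex_on_is_norm] continuous_on_subset by blast

text \<open>\<open>N\<close> attains its minimum on the compact Euclidean unit sphere; this minimum
  is positive by definiteness, and homogeneity carries it to all vectors.\<close>

lemma is_norm_lower_bound:
  fixes N :: "real ^ 'n \<Rightarrow> real"
  assumes "is_norm N"
  obtains c where "c > 0" "\<And>x. c * norm x \<le> N x"
proof -
  obtain z where z: "z \<in> sphere 0 1" and min: "\<And>x. x \<in> sphere 0 1 \<Longrightarrow> N z \<le> N x"
    using continuous_attains_inf[of "sphere (0::real^'n) 1" N] continuous_on_is_norm[OF assms]
    by auto
  show thesis
  proof
    show "N z > 0"
      using z is_norm_nonneg[OF assms, of z] is_norm_eq_0[OF assms, of z] by force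
    fix x
    show "N z * norm x \<le> N x"
    proof (cases "x = 0")
      case False
      then have "N z \<le> N (inverse (norm x) *\<^sub>R x)"
        by (intro min) simp
      then show ?thesis
        using False by (simp add: is_norm_scale[OF assms] field_simps)
    qed (use is_norm_nonneg[OF assms] in simp)
  qed
qed

text \<open>The supremum in \<open>dual_norm\<close> is taken in the reals, where its bounding
  properties hold only for sets bounded above.\<close>

lemma bdd_above_dual_norm:
  fixes N :: "real ^ 'n \<Rightarrow> real"
  assumes "is_norm N"
  shows "bdd_above ((\<lambda>x. \<bar>u \<bullet> x\<bar>) ` {x. N x \<le> 1})"
proof -
  obtain c where c: "c > 0" "\<And>x. c * norm x \<le> N x"
    using is_norm_lower_bound[OF assms] by blast
  show ?thesis
  proof (rule bdd_aboveI2)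
    fix x assume "x \<in> {x. N x \<le> 1}"
    then have "norm x \<le> 1 / c"
      using c(2)[of x] c(1) by (simp add: field_simps)
    then show "\<bar>u \<bullet> x\<bar> \<le> norm u * (1 / c)"
      using Cauchy_Schwarz_ineq2[of u x] mult_left_mono[of "norm x" "1 / c" "norm u"] by simp
  qed
qed

lemma inner_le_dual_norm:
  assumes "is_norm N"
  shows "\<bar>u \<bullet> x\<bar> \<le> dual_norm N u * N x"
proof (cases "x = 0")
  case True
  then show ?thesis by (simp add: is_norm_eq_0[OF assms, of 0, simplified])
next
  case False
  then have pos: "N x > 0"
    using is_norm_nonneg[OF assms, of x] is_norm_eq_0[OF assms, of x] by linarith
  have "\<bar>u \<bullet> (inverse (N x) *\<^sub>R x)\<bar> \<le> dual_norm N u"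
    unfolding dual_norm_def
    by (rule cSUP_upper[OF _ bdd_above_dual_norm[OF assms]])
       (use pos in \<open>simp add: is_norm_scale[OF assms]\<close>)
  then show ?thesis
    using pos by (simp add: abs_mult field_simps)
qed

lemma dual_norm_le:
  assumes "is_norm N" "\<And>x. N x \<le> 1 \<Longrightarrow> \<bar>u \<bullet> x\<bar> \<le> B"
  shows "dual_norm N u \<le> B"
proof -
  have "0 \<in> {x. N x \<le> 1}"
    by (simp add: is_norm_eq_0[OF assms(1), of 0, simplified])
  then show ?thesis
    unfolding dual_norm_def by (intro cSUP_least) (use assms(2) in auto)
qed

lemma dual_norm_nonneg:
  assumes "is_norm N"
  shows "0 \<le> dual_norm N u"
proof -
  have "N 0 = 0"
    by (simp add: is_norm_eq_0[OF assms])
  then have "\<bar>u \<bullet> 0\<bar> \<le> dual_norm N u"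
    unfolding dual_norm_def by (intro cSUP_upper[OF _ bdd_above_dual_norm[OF assms]]) simp
  then show ?thesis by simp
qed

lemma is_norm_dual_norm:
  fixes N :: "real ^ 'n \<Rightarrow> real"
  assumes "is_norm N"
  shows "is_norm (dual_norm N)"
proof -
  have 0: "dual_norm N u = 0 \<longleftrightarrow> u = 0" for u
  proof
    assume "dual_norm N u = 0"
    \<comment> \<open>The duality inequality is tested with \<open>u\<close> itself.\<close>
    then have "u \<bullet> u \<le> 0"
      using inner_le_dual_norm[OF assms, of u u] by simp
    then show "u = 0"
      by (metis inner_gt_zero_iff not_le)
  next
    assume "u = 0"
    then have "dual_norm N u \<le> 0"
      by (intro dual_norm_le[OF assms]) simp
    then show "dual_norm N u = 0"
      using dual_norm_nonneg[OF assms, of u] by linarith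
  qed
  have le: "dual_norm N (c *\<^sub>R u) \<le> \<bar>c\<bar> * dual_norm N u" for c u
  proof (rule dual_norm_le[OF assms])
    fix x assume "N x \<le> 1"
    then have "\<bar>u \<bullet> x\<bar> \<le> dual_norm N u"
      using inner_le_dual_norm[OF assms, of u x] mult_left_mono[of "N x" 1 "dual_norm N u"]
        dual_norm_nonneg[OF assms, of u] by simp
    then show "\<bar>c *\<^sub>R u \<bullet> x\<bar> \<le> \<bar>c\<bar> * dual_norm N u"
      by (simp add: abs_mult mult_left_mono)
  qed
  have scale: "dual_norm N (c *\<^sub>R u) = \<bar>c\<bar> * dual_norm N u" for c u
  proof (cases "c = 0")
    case False
    \<comment> \<open>The reverse of \<open>le\<close> follows from \<open>le\<close> itself,
      applied to the factor \<open>inverse c\<close> and the vector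
      \<open>c *\<^sub>R u\<close>.\<close>
    have "\<bar>c\<bar> * dual_norm N (inverse c *\<^sub>R (c *\<^sub>R u)) \<le> \<bar>c\<bar> * (\<bar>inverse c\<bar> * dual_norm N (c *\<^sub>R u))"
      by (intro mult_left_mono le) simp
    then have "\<bar>c\<bar> * dual_norm N u \<le> dual_norm N (c *\<^sub>R u)"
      using False by (simp add: field_simps)
    then show ?thesis using le[of c u] by linarith
  qed (use 0[of 0] in simp)
  have "dual_norm N (u + v) \<le> dual_norm N u + dual_norm N v" for u v
  proof (rule dual_norm_le[OF assms])
    fix x assume x: "N x \<le> 1"
    have "\<bar>w \<bullet> x\<bar> \<le> dual_norm N w" for w
      using x inner_le_dual_norm[OF assms, of w x] mult_left_mono[of "N x" 1 "dual_norm N w"]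
        dual_norm_nonneg[OF assms, of w] by simp
    from this[of u] this[of v] show "\<bar>(u + v) \<bullet> x\<bar> \<le> dual_norm N u + dual_norm N v"
      by (simp add: inner_add_left)
  qed
  then show ?thesis
    unfolding is_norm_def using 0 scale by blast
qed

section \<open>Nearest points in the norm \<open>N\<close> and their normals\<close>

lemma nearest_point_exists:
  fixes N :: "real ^ 'n \<Rightarrow> real"
  assumes "is_norm N" "closed F" "F \<noteq> {}"
  obtains y where "y \<in> F" "\<And>f. f \<in> F \<Longrightarrow> N (x - y) \<le> N (x - f)"
proof -
  obtain c where c: "c > 0" "\<And>x. c * norm x \<le> N x"
    using is_norm_lower_bound[OF assms(1)] by blast
  obtain f0 where f0: "f0 \<in> F" using assms(3) by blast
  \<comment> \<open>Every point at least as near to \<open>x\<close> as \<open>f0\<close> lies in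
    \<open>cball x R\<close>, so it suffices to minimise over a compact piece of
    \<open>F\<close>.\<close>
  define R where "R = N (x - f0) / c"
  have R: "f \<in> cball x R" if "N (x - f) \<le> N (x - f0)" for f
    using c(2)[of "x - f"] c(1) that by (simp add: R_def dist_norm field_simps)
  have "continuous_on (F \<inter> cball x R) (\<lambda>f. N (x - f))"
    by (rule continuous_on_compose2[OF continuous_on_is_norm[OF assms(1), of UNIV]])
       (auto intro!: continuous_intros)
  then obtain y where y: "y \<in> F \<inter> cball x R"
      and min: "\<And>f. f \<in> F \<inter> cball x R \<Longrightarrow> N (x - y) \<le> N (x - f)"
    using continuous_attains_inf[of "F \<inter> cball x R" "\<lambda>f. N (x - f)"] f0 R[of f0]
      closed_Int_compact[OF assms(2) compact_cball] by blast
  show thesis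
  proof
    show "y \<in> F" using y by blast
    fix f assume "f \<in> F"
    then show "N (x - y) \<le> N (x - f)"
      using min[of f] min[of f0] f0 R[of f] R[of f0] by (cases "N (x - f) \<le> N (x - f0)") auto
  qed
qed

text \<open>Let \<beta> be the level separating \<open>F\<close> from the open \<open>N\<close>-ball
  of radius \<open>N (x - y)\<close> around \<open>x\<close>. The ball lying above \<beta> gives
  \<open>dual_norm N u * N (x - y) \<le> u \<bullet> x - \<beta>\<close>, and
  \<open>y \<in> F\<close> gives \<open>u \<bullet> y \<le> \<beta>\<close>. The duality inequality
  turns this chain into equalities, so \<beta> is \<open>u \<bullet> y\<close>.\<close>

lemma nearest_point_normal:
  fixes N :: "real ^ 'n \<Rightarrow> real"
  assumes N: "is_norm N" and "convex F" "y \<in> F"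
    and min: "\<And>f. f \<in> F \<Longrightarrow> N (x - y) \<le> N (x - f)" and pos: "N (x - y) > 0"
  obtains u where "u \<noteq> 0" "u \<bullet> (x - y) = dual_norm N u * N (x - y)"
    "\<And>f. f \<in> F \<Longrightarrow> u \<bullet> f \<le> u \<bullet> y"
proof -
  let ?r = "N (x - y)"
  let ?B = "{z. N (x - z) < ?r}"
  have "convex ?B"
  proof (rule convexI)
    fix z w and s t :: real
    assume z: "z \<in> ?B" and w: "w \<in> ?B" and st: "0 \<le> s" "0 \<le> t" "s + t = 1"
    have "x - (s *\<^sub>R z + t *\<^sub>R w) = (s + t) *\<^sub>R x - (s *\<^sub>R z + t *\<^sub>R w)"
      using st by simp
    also have "\<dots> = s *\<^sub>R (x - z) + t *\<^sub>R (x - w)"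
      by (simp add: algebra_simps)
    finally have "N (x - (s *\<^sub>R z + t *\<^sub>R w)) \<le> s * N (x - z) + t * N (x - w)"
      using is_norm_triangle[OF N, of "s *\<^sub>R (x - z)" "t *\<^sub>R (x - w)"] st
      by (simp add: is_norm_scale[OF N])
    also have "\<dots> < ?r"
      using convex_bound_lt[of "N (x - z)" ?r "N (x - w)" s t] z w st by simp
    finally show "s *\<^sub>R z + t *\<^sub>R w \<in> ?B" by simp
  qed
  moreover have "x \<in> ?B"
    using pos by (simp add: is_norm_eq_0[OF N, of 0, simplified])
  moreover have "F \<inter> ?B = {}"
    using min by force
  ultimately obtain u \<beta> where u: "u \<noteq> 0" and F: "\<And>f. f \<in> F \<Longrightarrow> u \<bullet> f \<le> \<beta>"
      and B: "\<And>z. z \<in> ?B \<Longrightarrow> \<beta> \<le> u \<bullet> z"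
    using separating_hyperplane_sets[of F ?B] \<open>convex F\<close> \<open>y \<in> F\<close> by blast
  \<comment> \<open>The ball is open, so \<open>w\<close> is first shrunk by a factor
    \<open>s < 1\<close>; the bound for \<open>w\<close> itself is the limit as \<open>s\<close>
    tends to 1.\<close>
  have le: "?r * (u \<bullet> w) \<le> u \<bullet> x - \<beta>" if w: "N w \<le> 1" for w
  proof (rule field_le_mult_one_interval)
    fix s :: real assume s: "0 < s" "s < 1"
    have "s * ?r * N w < ?r"
    proof -
      have "s * ?r * N w \<le> s * ?r * 1"
        using w s pos by (intro mult_left_mono) auto
      also have "\<dots> < ?r" using s pos by simp
      finally show ?thesis .
    qed
    then have "x - (s * ?r) *\<^sub>R w \<in> ?B"
      using s pos by (simp add: is_norm_scale[OF N] abs_mult)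
    from B[OF this] show "s * (?r * (u \<bullet> w)) \<le> u \<bullet> x - \<beta>"
      by (simp add: inner_diff_right)
  qed
  have "dual_norm N u \<le> (u \<bullet> x - \<beta>) / ?r"
  proof (rule dual_norm_le[OF N])
    fix w assume "N w \<le> 1"
    then show "\<bar>u \<bullet> w\<bar> \<le> (u \<bullet> x - \<beta>) / ?r"
      using le[of w] le[of "- w"] pos
      by (simp add: is_norm_minus[OF N] abs_le_iff field_simps)
  qed
  then have "dual_norm N u * ?r \<le> u \<bullet> x - \<beta>"
    using pos by (simp add: field_simps)
  moreover have "u \<bullet> (x - y) \<le> dual_norm N u * ?r"
    using inner_le_dual_norm[OF N, of u "x - y"] by linarith
  ultimately show thesis
    using that[of u] u F F[OF \<open>y \<in> F\<close>] by (force simp: inner_diff_right)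
qed

section \<open>Extreme points and convex cones\<close>

text \<open>Induction on the dimension. An affine set without lines is a single point; otherwise a
  supporting hyperplane at a relative boundary point cuts out a proper face, of smaller dimension,
  and extreme points of a face are extreme in the whole set.\<close>

lemma closed_convex_no_line_extreme_point:
  fixes S :: "'a::euclidean_space set"
  assumes "closed S" "convex S" "S \<noteq> {}"
    and "\<And>x d. (\<And>t. x + t *\<^sub>R d \<in> S) \<Longrightarrow> d = 0"
  obtains e where "e extreme_point_of S"
proof -
  have "\<exists>e. e extreme_point_of S"
    using assms
  proof (induction "nat (aff_dim S)" arbitrary: S rule: less_induct)
    case less
    show ?case
    proof (cases "affine S")
      case True
      obtain x where x: "x \<in> S" using less.prems(3) by blast
      have "y = x" if y: "y \<in> S" for y
      proof -
        have "x + t *\<^sub>R (y - x) \<in> S" for t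
          using mem_affine_3_minus[OF True x y x] by simp
        then show ?thesis
          using less.prems(4)[of x "y - x"] by simp
      qed
      then have "S = {x}" using x by blast
      then show ?thesis by auto
    next
      case False
      then have "rel_frontier S \<noteq> {}"
        by (simp add: rel_frontier_eq_empty)
      then obtain z where z: "z \<in> S" "z \<notin> rel_interior S"
        using \<open>closed S\<close> by (auto simp: rel_frontier_def)
      obtain p where p: "\<And>y. y \<in> S \<Longrightarrow> p \<bullet> z \<le> p \<bullet> y"
          and p': "\<And>y. y \<in> rel_interior S \<Longrightarrow> p \<bullet> z < p \<bullet> y"
        using supporting_hyperplane_rel_boundary[OF \<open>convex S\<close> z] by metis
      define T where "T = S \<inter> {x. p \<bullet> x = p \<bullet> z}"
      have face: "T face_of S"
        unfolding T_def by (rule face_of_Int_supporting_hyperplane_ge[OF \<open>convex S\<close> p])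
      have "rel_interior S \<noteq> {}"
        using rel_interior_eq_empty[OF \<open>convex S\<close>] \<open>S \<noteq> {}\<close> by blast
      then obtain y where "y \<in> rel_interior S" by blast
      then have "y \<in> S" "y \<notin> T"
        using p'[of y] rel_interior_subset[of S] by (auto simp: T_def)
      then have "T \<noteq> S" by blast
      then have "aff_dim T < aff_dim S"
        using face_of_aff_dim_lt[OF \<open>convex S\<close> face] by blast
      moreover have "z \<in> T" using z by (simp add: T_def)
      \<comment> \<open>The empty set has dimension -1, which \<open>nat\<close> would identify with
        0; nonemptiness keeps the decrease strict.\<close>
      then have "aff_dim T \<ge> 0"
        by (metis aff_dim_negative_iff empty_iff not_le)
      ultimately have "nat (aff_dim T) < nat (aff_dim S)" by linarith
      moreover have "closed T"
        unfolding T_def by (intro closed_Int \<open>closed S\<close> closed_hyperplane)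
      moreover have "convex T"
        using face face_of_imp_convex by blast
      moreover have "T \<noteq> {}" using \<open>z \<in> T\<close> by blast
      moreover have "d = 0" if "\<And>t. x + t *\<^sub>R d \<in> T" for x d
        using less.prems(4)[of x d] that by (simp add: T_def)
      ultimately obtain e where "e extreme_point_of T"
        using less.hyps[of T] by blast
      then show ?thesis
        using extreme_point_of_face[OF face] by blast
    qed
  qed
  then show thesis using that by blast
qed

text \<open>The open half-space below level \<open>c\<close>, joined with the hull of the points of
  \<open>S\<close> at level \<open>c\<close>, is still convex: a proper combination involving a
  point strictly below stays strictly below. It contains \<open>S\<close>, hence its hull, and
  \<open>z\<close> is not in the half-space.\<close>

lemma convex_hull_supporting_hyperplane:
  assumes "z \<in> convex hull S" "\<And>s. s \<in> S \<Longrightarrow> q \<bullet> s \<le> c" "q \<bullet> z = c"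
  shows "z \<in> convex hull {s \<in> S. q \<bullet> s = c}"
proof -
  define C where "C = convex hull {s \<in> S. q \<bullet> s = c}"
  have C: "C \<subseteq> {s. q \<bullet> s = c}"
    unfolding C_def by (intro hull_minimal) (auto simp: convex_hyperplane)
  have "convex ({w. q \<bullet> w < c} \<union> C)"
  proof (rule convexI)
    fix x y and s t :: real
    assume x: "x \<in> {w. q \<bullet> w < c} \<union> C" and y: "y \<in> {w. q \<bullet> w < c} \<union> C"
      and st: "0 \<le> s" "0 \<le> t" "s + t = 1"
    show "s *\<^sub>R x + t *\<^sub>R y \<in> {w. q \<bullet> w < c} \<union> C"
    proof (cases "s = 0 \<or> t = 0 \<or> (x \<in> C \<and> y \<in> C)")
      case True
      then show ?thesis
        using x y st convexD[of C x y s t] convex_convex_hull[of "{s \<in> S. q \<bullet> s = c}"]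
        unfolding C_def by auto
    next
      case False
      then have "s > 0" "t > 0" using st by auto
      moreover have "q \<bullet> x \<le> c" "q \<bullet> y \<le> c" "q \<bullet> x < c \<or> q \<bullet> y < c"
        using x y C False by auto
      ultimately have "s * (q \<bullet> x) + t * (q \<bullet> y) < s * c + t * c"
        by (smt (verit) mult_left_mono mult_strict_left_mono)
      also have "\<dots> = c" using st by (metis distrib_right mult_1)
      finally show ?thesis by (simp add: inner_add_right)
    qed
  qed
  moreover have "S \<subseteq> {w. q \<bullet> w < c} \<union> C"
    using assms(2) hull_subset[of "{s \<in> S. q \<bullet> s = c}" convex] unfolding C_def by force
  ultimately have "convex hull S \<subseteq> {w. q \<bullet> w < c} \<union> C"
    by (rule hull_minimal[rotated])
  then show ?thesis
    using assms(1,3) unfolding C_def by auto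
qed

text \<open>The nontrivial half of the bipolar theorem: a functional separating \<open>u\<close>
  from the closed cone is, up to sign, in the polar of the cone.\<close>

lemma closure_convex_cone_hullI:
  fixes S :: "'a::euclidean_space set"
  assumes "\<And>p. (\<And>s. s \<in> convex_cone hull S \<Longrightarrow> p \<bullet> s \<le> 0) \<Longrightarrow> u \<bullet> p \<le> 0"
  shows "u \<in> closure (convex_cone hull S)"
proof (rule ccontr)
  assume "u \<notin> closure (convex_cone hull S)"
  then obtain p \<beta> where p: "p \<bullet> u < \<beta>" "\<And>s. s \<in> closure (convex_cone hull S) \<Longrightarrow> p \<bullet> s > \<beta>"
    using separating_hyperplane_closed_point[of "closure (convex_cone hull S)" u]
    by (auto simp: convex_closure convex_convex_cone_hull)
  have p': "p \<bullet> s > \<beta>" if "s \<in> convex_cone hull S" for s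
    using p(2) that closure_subset by blast
  have "\<beta> < 0"
    using p'[OF convex_cone_hull_contains_0] by simp
  have "(- p) \<bullet> s \<le> 0" if s: "s \<in> convex_cone hull S" for s
  proof (rule ccontr)
    assume "\<not> (- p) \<bullet> s \<le> 0"
    then have neg: "p \<bullet> s < 0" by simp
    \<comment> \<open>The factor is positive and brings the value down to exactly \<beta>, which
      strict separation forbids.\<close>
    have "p \<bullet> ((\<beta> / (p \<bullet> s)) *\<^sub>R s) > \<beta>"
      by (intro p' convex_cone_hull_mul s) (use neg \<open>\<beta> < 0\<close> in \<open>simp add: divide_nonpos_neg\<close>)
    then show False using neg by simp
  qed
  then have "u \<bullet> (- p) \<le> 0" by (rule assms)
  then show False
    using p(1) \<open>\<beta> < 0\<close> by (simp add: inner_commute)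
qed


text \<open>The gauge of \<open>convex hull (insert 0 K)\<close> at \<open>v\<close> is the supremum of \<open>v \<bullet> q\<close> over the polar of
  \<open>K\<close>. For \<open>v\<close> in the relative interior of the cone this supremum is attained, and then \<open>v\<close> is a
  multiple of a point of the face of \<open>K\<close> exposed by \<open>q\<close>; it may fail to be attained on the
  relative boundary, which is reached by continuity.\<close>

lemma inner_le_if_exposed_faces_far:
  fixes K :: "(real ^ 'n) set"
  assumes P: "is_norm P" and K: "compact K"
    and far: "\<And>q w. (\<And>k. k \<in> K \<Longrightarrow> k \<bullet> q \<le> 1) \<Longrightarrow> w \<in> convex hull {k \<in> K. k \<bullet> q = 1} \<Longrightarrow> 1 \<le> M * P w"
    and d: "\<And>k. k \<in> K \<Longrightarrow> k \<bullet> d \<le> 1"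
    and v: "v \<in> closure (convex_cone hull K)"
  shows "v \<bullet> d \<le> M * P v"
proof -
  let ?A = "convex_cone hull K" and ?C = "convex hull (insert 0 K)"
  have rel: "v \<bullet> d \<le> M * P v" if v: "v \<in> rel_interior ?A" for v
  proof (cases "v = 0")
    case True
    then show ?thesis by (simp add: is_norm_eq_0[OF P, of 0, simplified])
  next
    case False
    have vA: "v \<in> ?A" using v rel_interior_subset by blast
    then obtain c w where w: "w \<in> convex hull K" and c: "0 \<le> c" "v = c *\<^sub>R w"
      using False by (auto simp: convex_cone_hull_separate conic_hull_explicit)
    have "c > 0" using c False by (cases "c = 0") auto
    have C: "compact ?C" "0 \<in> ?C" "convex ?C"
      using K by (auto intro: compact_convex_hull compact_insert hull_inc)
    have CA: "?C \<subseteq> ?A"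
      by (intro hull_minimal)
        (auto simp: convex_convex_cone_hull convex_cone_hull_contains_0 hull_inc)
    \<comment> \<open>\<open>Z\<close> is the part of \<open>?C\<close> on the line through
      \<open>v\<close>. Its maximiser \<open>z = s *\<^sub>R v\<close> is the last point of
      \<open>?C\<close> on the ray of \<open>v\<close>, so \<open>1 / s\<close> is the gauge of
      \<open>?C\<close> at \<open>v\<close>.\<close>
    define Z where "Z = ?C \<inter> span {v}"
    have wZ: "w \<in> Z"
    proof -
      have "w = (1 / c) *\<^sub>R v" using c \<open>c > 0\<close> by simp
      moreover have "w \<in> ?C" using w hull_mono[of K "insert 0 K" convex] by blast
      ultimately show ?thesis
        unfolding Z_def by (metis IntI span_base span_scale insertI1)
    qed
    have "compact Z"
      unfolding Z_def
      by (intro compact_Int_closed C closed_subspace subspace_span)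
    moreover have "continuous_on Z ((\<bullet>) v)"
      by (intro continuous_intros)
    ultimately obtain z where z: "z \<in> Z" and max: "\<And>y. y \<in> Z \<Longrightarrow> v \<bullet> y \<le> v \<bullet> z"
      using continuous_attains_sup[of Z "(\<bullet>) v"] wZ by blast
    from z obtain s where s: "z = s *\<^sub>R v" and zC: "z \<in> ?C"
      unfolding Z_def by (auto simp: span_singleton)
    have "c * (v \<bullet> w) = v \<bullet> v" using c(2) by (metis inner_scaleR_right)
    then have "c * (v \<bullet> w) > 0" using False by simp
    then have vz: "v \<bullet> z > 0"
      using max[OF wZ] \<open>c > 0\<close> by (simp add: zero_less_mult_iff)
    moreover have "v \<bullet> v > 0" using False by simp
    ultimately have "s > 0"
      using s by (simp add: zero_less_mult_iff)
    \<comment> \<open>Otherwise the segment from 0 to \<open>z\<close> could be prolonged inside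
      \<open>?C\<close>, against maximality.\<close>
    have "z \<notin> rel_interior ?C"
    proof
      assume "z \<in> rel_interior ?C"
      then obtain e where e: "e > 1" "(1 - e) *\<^sub>R 0 + e *\<^sub>R z \<in> ?C"
        using convex_rel_interior_iff[OF C(3)] C(2) by blast
      then have "e *\<^sub>R z \<in> Z"
        using z unfolding Z_def by (simp add: span_scale)
      from max[OF this] show False using e(1) vz by simp
    qed
    then obtain p where p: "\<And>y. y \<in> ?C \<Longrightarrow> p \<bullet> z \<le> p \<bullet> y"
        and p': "\<And>y. y \<in> rel_interior ?C \<Longrightarrow> p \<bullet> z < p \<bullet> y"
      using supporting_hyperplane_rel_boundary[OF C(3) zC] by metis
    \<comment> \<open>Here \<open>v\<close> being in the relative interior of the cone matters: if
      \<open>p\<close> vanished at \<open>v\<close>, then, being nonnegative on the cone, it would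
      vanish on all of it, since segments ending at \<open>v\<close> can be prolonged. That
      contradicts \<open>p'\<close>.\<close>
    have "p \<bullet> z \<noteq> 0"
    proof
      assume 0: "p \<bullet> z = 0"
      then have pv: "p \<bullet> v = 0" using s \<open>s > 0\<close> by simp
      have nonneg: "?A \<subseteq> {x. p \<bullet> x \<ge> 0}"
        by (rule hull_minimal) (use p 0 in \<open>auto intro: hull_inc convex_cone_halfspace_ge\<close>)
      have "p \<bullet> y \<le> 0" if y: "y \<in> ?A" for y
      proof -
        obtain e where e: "e > 1" "(1 - e) *\<^sub>R y + e *\<^sub>R v \<in> ?A"
          using convex_rel_interior_iff[OF convex_convex_cone_hull convex_cone_hull_nonempty] v y by blast
        then have "0 \<le> (1 - e) * (p \<bullet> y)"
          using nonneg pv by (auto simp: inner_add_right)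
        then show ?thesis using e(1) by (simp add: zero_le_mult_iff)
      qed
      moreover obtain y where "y \<in> rel_interior ?C"
        using rel_interior_eq_empty[OF C(3)] C(2) by blast
      ultimately show False
        using p'[of y] 0 CA rel_interior_subset[of ?C] by force
    qed
    then have pz: "p \<bullet> z < 0" using p[OF C(2)] by simp
    \<comment> \<open>Dividing by the negative number \<open>p \<bullet> z\<close> reverses the
      inequality: \<open>q\<close> is at most 1 on \<open>?C\<close> with equality at
      \<open>z\<close>, and 0 is not among the points where it equals 1.\<close>
    define q where "q = (1 / (p \<bullet> z)) *\<^sub>R p"
    have q: "q \<bullet> y \<le> 1" if "y \<in> ?C" for y
      using p[OF that] pz by (simp add: q_def divide_le_eq)
    have qz: "q \<bullet> z = 1" using pz by (simp add: q_def)
    have "z \<in> convex hull {k \<in> insert 0 K. q \<bullet> k = 1}"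
      by (rule convex_hull_supporting_hyperplane[OF zC _ qz]) (auto intro: q hull_inc)
    also have "{k \<in> insert 0 K. q \<bullet> k = 1} = {k \<in> K. k \<bullet> q = 1}"
      by (auto simp: inner_commute)
    finally have "1 \<le> M * P z"
      by (rule far[rotated]) (metis q inner_commute hull_inc insertCI)
    also have "\<dots> = s * (M * P v)"
      using s \<open>s > 0\<close> by (simp add: is_norm_scale[OF P])
    finally have 1: "1 \<le> s * (M * P v)" .
    \<comment> \<open>The constraint on \<open>d\<close> passes from \<open>K\<close> to
      \<open>?C\<close>, in particular to \<open>z\<close>; comparison with \<open>1\<close> and
      cancellation of \<open>s\<close> finish the case.\<close>
    have "?C \<subseteq> {y. d \<bullet> y \<le> 1}"
      by (intro hull_minimal convex_halfspace_le) (use d in \<open>auto simp: inner_commute\<close>)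
    then have "s * (v \<bullet> d) \<le> 1"
      using zC s by (auto simp: inner_commute)
    with 1 have "s * (v \<bullet> d) \<le> s * (M * P v)" by linarith
    then show ?thesis using \<open>s > 0\<close> by simp
  qed
  have "closed {v. v \<bullet> d \<le> M * P v}"
    by (intro closed_Collect_le continuous_intros continuous_on_is_norm[OF P])
  then have "closure (rel_interior ?A) \<subseteq> {v. v \<bullet> d \<le> M * P v}"
    by (intro closure_minimal) (use rel in auto)
  then show ?thesis
    using v convex_closure_rel_interior[OF convex_convex_cone_hull[of K]] by auto
qed

section \<open>Linear inequality systems\<close>

lemma closed_feasible: "closed (feasible a b)"
proof -
  have "feasible a b = (\<Inter>t. {x. a t \<bullet> x \<le> apply_bcontfun b t})"
    by (auto simp: feasible_def)
  then show ?thesis by (simp add: closed_INT closed_halfspace_le)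
qed

lemma convex_feasible: "convex (feasible a b)"
proof -
  have "feasible a b = (\<Inter>t. {x. a t \<bullet> x \<le> apply_bcontfun b t})"
    by (auto simp: feasible_def)
  then show ?thesis by (simp add: convex_INT convex_halfspace_le)
qed

lemma compact_active_image:
  fixes a :: "'t::metric_space \<Rightarrow> real ^ 'n"
  assumes "compact (UNIV :: 't set)" "continuous_on UNIV a"
  shows "compact (a ` active_set a b x)"
proof -
  have "closed (active_set a b x)"
    unfolding active_set_def
    by (intro closed_Collect_eq continuous_intros assms(2)) auto
  then have "compact (active_set a b x)"
    using compact_Int_closed[OF assms(1)] by simp
  then show ?thesis
    using compact_continuous_image continuous_on_subset[OF assms(2)] by blast
qed

lemma feasible_cong_orthogonal:
  assumes "\<And>t. a t \<bullet> x = a t \<bullet> y"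
  shows "x \<in> feasible a b \<longleftrightarrow> y \<in> feasible a b"
  by (simp add: feasible_def assms)

section \<open>Normals and extreme points under local polyhedrality\<close>

text \<open>By local polyhedrality each \<open>p\<close> in the polar of the active cone is a
  feasible direction, along which \<open>u\<close> cannot increase; the bipolar criterion applies.
  The closure appears because a cone generated by a compact set need not be closed.\<close>

lemma normal_in_closure_active_cone:
  assumes "locally_polyhedral a b" "x \<in> feasible a b"
    and max: "\<And>f. f \<in> feasible a b \<Longrightarrow> u \<bullet> f \<le> u \<bullet> x"
  shows "u \<in> closure (active_cone a b x)"
  unfolding active_cone_def
proof (rule closure_convex_cone_hullI)
  fix p assume "\<And>s. s \<in> convex_cone hull (a ` active_set a b x) \<Longrightarrow> p \<bullet> s \<le> 0"
  then have "p \<in> neg_polar (active_cone a b x)"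
    by (simp add: neg_polar_def active_cone_def)
  then have "p \<in> feasible_directions (feasible a b) x"
    using assms(1,2) unfolding locally_polyhedral_def by blast
  then obtain \<epsilon> where "\<epsilon> > 0" "x + \<epsilon> *\<^sub>R p \<in> feasible a b"
    unfolding feasible_directions_def by force
  from max[OF this(2)] this(1) show "u \<bullet> p \<le> 0"
    by (simp add: inner_add_right mult_le_0_iff)
qed

lemma maximal_extreme_point_exists:
  fixes a :: "'t::metric_space \<Rightarrow> real ^ 'n"
  assumes "locally_polyhedral a b" "y \<in> feasible a b"
    and max: "\<And>f. f \<in> feasible a b \<Longrightarrow> u \<bullet> f \<le> u \<bullet> y"
  obtains e where "e \<in> extreme_points a b" "u \<bullet> e = u \<bullet> y"
proof -
  let ?S = "feasible a b \<inter> span (range a)"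
  let ?G = "?S \<inter> {x. u \<bullet> x = u \<bullet> y}"
  have aspan: "a t \<in> span (range a)" for t by (simp add: span_base)
  \<comment> \<open>Since \<open>u\<close> lies in the span, replacing \<open>y\<close> by its
    orthogonal projection \<open>z\<close> changes neither feasibility nor the value of
    \<open>u\<close>.\<close>
  have "active_cone a b y \<subseteq> span (range a)"
    unfolding active_cone_def
    by (intro hull_minimal subspace_imp_convex_cone subspace_span) (auto intro: span_base)
  then have "closure (active_cone a b y) \<subseteq> span (range a)"
    by (intro closure_minimal closed_subspace subspace_span)
  then have u: "u \<in> span (range a)"
    using normal_in_closure_active_cone[OF assms] by blast
  obtain z w where z: "z \<in> span (range a)" and w: "\<And>v. v \<in> span (range a) \<Longrightarrow> orthogonal w v"
      and y: "y = z + w"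
    using orthogonal_subspace_decomp_exists[of "range a" y] by metis
  have eq: "v \<bullet> z = v \<bullet> y" if "v \<in> span (range a)" for v
    using w[OF that] y by (simp add: orthogonal_def inner_add_right inner_commute)
  have "z \<in> ?G"
    using z eq[OF u] feasible_cong_orthogonal[of a z y] eq[OF aspan] assms(2) by simp
  have S: "convex ?S" "closed ?S"
    by (auto intro: convex_Int closed_Int convex_feasible closed_feasible subspace_imp_convex
        closed_subspace)
  have face: "?G face_of ?S"
    by (rule face_of_Int_supporting_hyperplane_le[OF S(1)]) (use max in blast)
  have "d = 0" if line: "\<And>t. x + t *\<^sub>R d \<in> ?G" for x d
  proof -
    have "x \<in> span (range a)" "x + d \<in> span (range a)"
      using line[of 0] line[of 1] by auto
    then have d: "d \<in> span (range a)"
      using span_diff[of "x + d" "range a" x] by simp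
    have "a t \<bullet> d = 0" for t
    proof (rule ccontr)
      assume ne: "a t \<bullet> d \<noteq> 0"
      \<comment> \<open>The parameter is chosen so that the left side equals
        \<open>apply_bcontfun b t + 1\<close>.\<close>
      have "a t \<bullet> (x + ((apply_bcontfun b t + 1 - a t \<bullet> x) / (a t \<bullet> d)) *\<^sub>R d) \<le> apply_bcontfun b t"
        using line unfolding feasible_def by blast
      then show False using ne by (simp add: inner_add_right)
    qed
    then have "orthogonal d v" if "v \<in> span (range a)" for v
      by (intro orthogonal_to_span[OF that]) (auto simp: orthogonal_def inner_commute)
    then have "d \<bullet> d = 0" using d by (simp add: orthogonal_def)
    then show ?thesis by simp
  qed
  moreover have "closed ?G" "convex ?G"
    using S by (auto intro: closed_Int closed_hyperplane convex_Int convex_hyperplane)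
  ultimately obtain e where "e extreme_point_of ?G"
    using closed_convex_no_line_extreme_point[of ?G] \<open>z \<in> ?G\<close> by blast
  then have "e extreme_point_of ?S" "e \<in> ?G"
    using extreme_point_of_face[OF face] by blast+
  then show thesis
    using that[of e] by (simp add: extreme_points_def)
qed

section \<open>Constraint violation and perturbations of the right-hand side\<close>

text \<open>The witness is the pointwise maximum of \<open>b\<close> and
  \<open>a t \<bullet> x\<close>, the least function above \<open>b\<close> that makes
  \<open>x\<close> feasible; compactness makes it bounded.\<close>

lemma mf_inverse_near:
  fixes a :: "'t::metric_space \<Rightarrow> real ^ 'n"
  assumes "compact (UNIV :: 't set)" "continuous_on UNIV a"
    and "\<And>t. a t \<bullet> x - apply_bcontfun b t \<le> m" "0 \<le> m"
  obtains c where "c \<in> mf_inverse (feasible a) x" "dist b c \<le> m"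
proof -
  let ?f = "\<lambda>t. max (apply_bcontfun b t) (a t \<bullet> x)"
  have cont: "continuous_on UNIV ?f"
    by (intro continuous_intros assms(2)) auto
  then have "?f \<in> bcontfun"
    using compact_imp_bounded[OF compact_continuous_image[OF cont assms(1)]]
    by (simp add: bcontfun_def)
  then have f: "apply_bcontfun (Bcontfun ?f) = ?f"
    by (rule Bcontfun_inverse)
  show thesis
  proof
    show "Bcontfun ?f \<in> mf_inverse (feasible a) x"
      by (simp add: mf_inverse_def feasible_def f)
    show "dist b (Bcontfun ?f) \<le> m"
    proof (rule dist_bound)
      fix t
      show "dist (apply_bcontfun b t) (apply_bcontfun (Bcontfun ?f) t) \<le> m"
        using assms(3)[of t] assms(4) unfolding f dist_real_def by linarith
    qed
  qed
qed

text \<open>Inactive indices near active ones may have \<open>a t \<bullet> d\<close> slightly above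
  1, hence the factor \<delta>. Indices with \<open>a t \<bullet> d \<ge> \<delta>\<close> form a
  compact set of inactive ones, where the slack has a positive lower bound \<eta> that small steps
  do not exhaust; all others gain less than \<delta> per unit step.\<close>

lemma max_violation_upper_bound:
  fixes a :: "'t::metric_space \<Rightarrow> real ^ 'n"
  assumes "compact (UNIV :: 't set)" "continuous_on UNIV a" "x \<in> feasible a b"
    and d: "\<And>t. t \<in> active_set a b x \<Longrightarrow> a t \<bullet> d \<le> 1" and "\<delta> > 1"
  shows "\<forall>\<^sub>F \<epsilon> in at_right 0. \<forall>t. a t \<bullet> (x + \<epsilon> *\<^sub>R d) - apply_bcontfun b t \<le> \<delta> * \<epsilon>"
proof -
  let ?g = "\<lambda>t. apply_bcontfun b t - a t \<bullet> x"
  let ?K = "{t. \<delta> \<le> a t \<bullet> d}"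
  have "closed ?K"
    by (intro closed_Collect_le continuous_intros assms(2))
  then have K: "compact ?K"
    using compact_Int_closed[OF assms(1)] by simp
  have pos: "?g t > 0" if "t \<in> ?K" for t
    using d[of t] that \<open>\<delta> > 1\<close> assms(3) unfolding active_set_def feasible_def
    by (force simp: order_less_le)
  have contg: "continuous_on ?K ?g"
    by (intro continuous_intros continuous_on_subset[OF assms(2)]) auto
  obtain \<eta> where \<eta>: "\<eta> > 0" "\<And>t. t \<in> ?K \<Longrightarrow> ?g t \<ge> \<eta>"
  proof (cases "?K = {}")
    case False
    then obtain t where "t \<in> ?K" "\<And>s. s \<in> ?K \<Longrightarrow> ?g t \<le> ?g s"
      using continuous_attains_inf[OF K False contg] by blast
    then show ?thesis using that[of "?g t"] pos by blast
  qed (use that[of 1] in auto)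
  have "compact (range (\<lambda>t. a t \<bullet> d))"
    by (intro compact_continuous_image assms(1) continuous_intros assms(2))
  then obtain B where B: "B > 0" "\<And>t. \<bar>a t \<bullet> d\<bar> \<le> B"
    using bounded_pos[of "range (\<lambda>t. a t \<bullet> d)"] compact_imp_bounded by auto
  show ?thesis
    unfolding eventually_at_right_field
  proof (intro exI[of _ "\<eta> / B"] conjI allI impI)
    show "\<eta> / B > 0" using \<eta> B by simp
    fix \<epsilon> t assume \<epsilon>: "0 < \<epsilon>" "\<epsilon> < \<eta> / B"
    show "a t \<bullet> (x + \<epsilon> *\<^sub>R d) - apply_bcontfun b t \<le> \<delta> * \<epsilon>"
    proof (cases "t \<in> ?K")
      case True
      have "\<epsilon> * (a t \<bullet> d) \<le> \<epsilon> * B"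
        using B(2)[of t] \<epsilon> by (intro mult_left_mono) auto
      also have "\<dots> \<le> \<eta>" using \<epsilon> B by (simp add: field_simps)
      also have "\<dots> \<le> ?g t" using \<eta>(2) True by blast
      finally have "a t \<bullet> (x + \<epsilon> *\<^sub>R d) - apply_bcontfun b t \<le> 0"
        by (simp add: inner_add_right)
      also have "0 \<le> \<delta> * \<epsilon>" using \<open>\<delta> > 1\<close> \<epsilon> by simp
      finally show ?thesis .
    next
      case False
      then have "\<epsilon> * (a t \<bullet> d) \<le> \<epsilon> * \<delta>"
        using \<epsilon> by (intro mult_left_mono) auto
      moreover have "a t \<bullet> x \<le> apply_bcontfun b t"
        using assms(3) by (simp add: feasible_def)
      ultimately show ?thesis
        by (simp add: inner_add_right mult.commute)
    qed
  qed
qed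


section \<open>Inverse distances in the extended nonnegative reals\<close>

lemma ennreal_inverse_antimono: "x \<le> y \<Longrightarrow> inverse y \<le> inverse (x :: ennreal)"
proof (cases "y = top \<or> x = 0")
  case False
  moreover assume "x \<le> y"
  ultimately show ?thesis
    by (cases x rule: ennreal_cases; cases y rule: ennreal_cases)
       (auto simp: inverse_ennreal ennreal_le_iff2 le_imp_inverse_le order_less_le top_unique)
qed auto

text \<open>Translates bounds on the inverse distance into real inequalities, the only form used
  below. For empty \<open>W\<close> the distance is infinite and both sides hold; if
  \<open>0 \<in> W\<close> the inverse is infinite and both sides fail.\<close>

lemma inverse_dist_to_set_le_iff:
  assumes P: "is_norm P" and "0 \<le> M"
  shows "inverse (dist_to_set (norm_dist P) 0 W) \<le> ennreal M \<longleftrightarrow> (\<forall>w\<in>W. 1 \<le> M * P w)"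
proof -
  have dist: "dist_to_set (norm_dist P) 0 W = (INF w\<in>W. ennreal (P w))"
    by (simp add: dist_to_set_def norm_dist_def is_norm_minus[OF P])
  show ?thesis
  proof
    assume le: "inverse (dist_to_set (norm_dist P) 0 W) \<le> ennreal M"
    show "\<forall>w\<in>W. 1 \<le> M * P w"
    proof
      fix w assume "w \<in> W"
      then have "dist_to_set (norm_dist P) 0 W \<le> ennreal (P w)"
        unfolding dist by (rule INF_lower)
      then have "inverse (ennreal (P w)) \<le> inverse (dist_to_set (norm_dist P) 0 W)"
        by (rule ennreal_inverse_antimono)
      then have inv: "inverse (ennreal (P w)) \<le> ennreal M" using le by (rule order_trans)
      have "P w \<noteq> 0"
      proof
        assume "P w = 0"
        then show False using inv by (simp add: top_unique)
      qed
      then have "P w > 0" using is_norm_nonneg[OF P, of w] by simp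
      then show "1 \<le> M * P w"
        using inv \<open>0 \<le> M\<close> by (simp add: inverse_ennreal field_simps)
    qed
  next
    assume *: "\<forall>w\<in>W. 1 \<le> M * P w"
    show "inverse (dist_to_set (norm_dist P) 0 W) \<le> ennreal M"
    proof (cases "W = {}")
      case True
      then show ?thesis using dist by simp
    next
      case False
      then have "M > 0" using * \<open>0 \<le> M\<close> by (cases "M = 0") auto
      have "ennreal (1 / M) \<le> dist_to_set (norm_dist P) 0 W"
        unfolding dist
      proof (rule INF_greatest)
        fix w assume "w \<in> W"
        then show "ennreal (1 / M) \<le> ennreal (P w)"
          using * \<open>M > 0\<close> by (intro ennreal_leI) (simp add: field_simps)
      qed
      then have "inverse (dist_to_set (norm_dist P) 0 W) \<le> inverse (ennreal (1 / M))"
        by (rule ennreal_inverse_antimono)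
      also have "\<dots> = ennreal M"
        using \<open>M > 0\<close> by (simp add: inverse_ennreal)
      finally show ?thesis .
    qed
  qed
qed

section \<open>Lower bound for calmness constants\<close>

text \<open>At \<open>e + \<epsilon> *\<^sub>R d\<close>, the normal \<open>w\<close> with
  \<open>w \<bullet> d = 1\<close> forces distance at least
  \<open>\<epsilon> / dual_norm N w\<close> to the feasible set, while a perturbation of
  \<open>b\<close> of size at most \<open>1 / s * \<epsilon>\<close> restores feasibility. Comparing
  both and letting \<open>s\<close> tend to 1 gives the claim.\<close>

lemma clm_constant_lower_bound:
  fixes a :: "'t::metric_space \<Rightarrow> real ^ 'n"
  assumes N: "is_norm N" and T: "compact (UNIV :: 't set)" "continuous_on UNIV a"
    and e: "e \<in> feasible a b" and D: "D \<in> supported_subsets a b e" and w: "w \<in> convex hull (a ` D)"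
    and "0 \<le> \<kappa>"
    and ev: "\<forall>\<^sub>F x in nhds e. dist_to_set (norm_dist N) x (feasible a b)
               \<le> ennreal \<kappa> * dist_to_set dist b (mf_inverse (feasible a) x)"
  shows "1 \<le> \<kappa> * dual_norm N w"
proof -
  obtain d where D': "D \<subseteq> active_set a b e" and d1: "\<And>t. t \<in> D \<Longrightarrow> a t \<bullet> d = 1"
      and d2: "\<And>t. t \<in> active_set a b e - D \<Longrightarrow> a t \<bullet> d < 1"
    using D unfolding supported_subsets_def by blast
  have d: "a t \<bullet> d \<le> 1" if "t \<in> active_set a b e" for t
    using d1[of t] d2[of t] that by fastforce
  have "convex hull (a ` D) \<subseteq> {y. d \<bullet> y = 1}"
    by (intro hull_minimal convex_hyperplane) (use d1 in \<open>auto simp: inner_commute\<close>)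
  then have wd: "w \<bullet> d = 1"
    using w by (auto simp: inner_commute)
  then have "w \<noteq> 0" by auto
  then have pos: "dual_norm N w > 0"
    using is_norm_eq_0[OF is_norm_dual_norm[OF N]] dual_norm_nonneg[OF N, of w]
    by (simp add: order_less_le)
  \<comment> \<open>Each \<open>a t\<close> with \<open>t \<in> D\<close> is active at
    \<open>e\<close>, hence a normal there, and normals are stable under convex combination.\<close>
  have wf: "w \<bullet> f \<le> w \<bullet> e" if f: "f \<in> feasible a b" for f
  proof -
    have "a t \<bullet> f \<le> a t \<bullet> e" if "t \<in> D" for t
      using that D' f by (auto simp: feasible_def active_set_def)
    then have "convex hull (a ` D) \<subseteq> {y. (f - e) \<bullet> y \<le> 0}"
      by (intro hull_minimal convex_halfspace_le)
         (auto simp: inner_diff_left inner_commute[of _ "a _"])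
    then have "(f - e) \<bullet> w \<le> 0"
      using w by blast
    then show ?thesis
      by (simp add: inner_diff_left inner_commute[of w])
  qed
  show ?thesis
  proof (rule field_le_mult_one_interval)
    fix s :: real assume s: "0 < s" "s < 1"
    have "filterlim (\<lambda>\<epsilon>. e + \<epsilon> *\<^sub>R d) (nhds e) (at_right 0)"
      by (rule tendsto_eq_intros refl | simp)+
    then have "\<forall>\<^sub>F \<epsilon> in at_right 0. dist_to_set (norm_dist N) (e + \<epsilon> *\<^sub>R d) (feasible a b)
        \<le> ennreal \<kappa> * dist_to_set dist b (mf_inverse (feasible a) (e + \<epsilon> *\<^sub>R d))"
      by (rule eventually_compose_filterlim[OF ev])
    moreover have "\<forall>\<^sub>F \<epsilon> in at_right 0. \<forall>t. a t \<bullet> (e + \<epsilon> *\<^sub>R d) - apply_bcontfun b t \<le> 1 / s * \<epsilon>"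
      by (rule max_violation_upper_bound[OF T e d]) (use s in auto)
    moreover have "\<forall>\<^sub>F \<epsilon> in at_right (0::real). \<epsilon> > 0"
      by (simp add: eventually_at_right_less)
    ultimately have "\<forall>\<^sub>F \<epsilon> in at_right 0. dist_to_set (norm_dist N) (e + \<epsilon> *\<^sub>R d) (feasible a b)
        \<le> ennreal \<kappa> * dist_to_set dist b (mf_inverse (feasible a) (e + \<epsilon> *\<^sub>R d)) \<and>
        (\<forall>t. a t \<bullet> (e + \<epsilon> *\<^sub>R d) - apply_bcontfun b t \<le> 1 / s * \<epsilon>) \<and> \<epsilon> > 0"
      by eventually_elim blast
    then obtain \<epsilon> where le: "dist_to_set (norm_dist N) (e + \<epsilon> *\<^sub>R d) (feasible a b)
        \<le> ennreal \<kappa> * dist_to_set dist b (mf_inverse (feasible a) (e + \<epsilon> *\<^sub>R d))"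
      and up: "\<And>t. a t \<bullet> (e + \<epsilon> *\<^sub>R d) - apply_bcontfun b t \<le> 1 / s * \<epsilon>" and \<epsilon>: "\<epsilon> > 0"
      using eventually_happens'[OF trivial_limit_at_right_real] by blast
    obtain c where c: "c \<in> mf_inverse (feasible a) (e + \<epsilon> *\<^sub>R d)" "dist b c \<le> 1 / s * \<epsilon>"
      using mf_inverse_near[OF T up] s \<epsilon> by auto
    have "ennreal (\<epsilon> / dual_norm N w) \<le> dist_to_set (norm_dist N) (e + \<epsilon> *\<^sub>R d) (feasible a b)"
      unfolding dist_to_set_def
    proof (rule INF_greatest)
      fix f assume "f \<in> feasible a b"
      then have "\<epsilon> \<le> w \<bullet> (e + \<epsilon> *\<^sub>R d - f)"
        using wf[of f] wd by (simp add: inner_diff_right inner_add_right)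
      also have "\<dots> \<le> dual_norm N w * N (e + \<epsilon> *\<^sub>R d - f)"
        using inner_le_dual_norm[OF N, of w "e + \<epsilon> *\<^sub>R d - f"] by linarith
      finally show "ennreal (\<epsilon> / dual_norm N w) \<le> ennreal (norm_dist N (e + \<epsilon> *\<^sub>R d) f)"
        using pos by (intro ennreal_leI) (simp add: norm_dist_def field_simps)
    qed
    also note le
    also have "dist_to_set dist b (mf_inverse (feasible a) (e + \<epsilon> *\<^sub>R d)) \<le> ennreal (dist b c)"
      unfolding dist_to_set_def using c(1) by (rule INF_lower)
    then have "ennreal \<kappa> * dist_to_set dist b (mf_inverse (feasible a) (e + \<epsilon> *\<^sub>R d))
        \<le> ennreal \<kappa> * ennreal (1 / s * \<epsilon>)"
      by (intro mult_left_mono) (use c(2) in \<open>auto elim: order_trans intro: ennreal_leI\<close>)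
    also have "\<dots> = ennreal (\<kappa> * (1 / s * \<epsilon>))"
      by (rule ennreal_mult[symmetric]) (use \<open>0 \<le> \<kappa>\<close> s \<epsilon> in auto)
    finally have "\<epsilon> / dual_norm N w \<le> \<kappa> * (1 / s * \<epsilon>)"
      using \<open>0 \<le> \<kappa>\<close> s \<epsilon> by (simp add: ennreal_le_iff)
    then show "s * 1 \<le> \<kappa> * dual_norm N w"
      using s \<epsilon> pos by (simp add: field_simps)
  qed
qed

section \<open>Upper bound for the Hoffman modulus\<close>

lemma global_error_bound:
  fixes a :: "'t::metric_space \<Rightarrow> real ^ 'n"
  assumes N: "is_norm N" and T: "compact (UNIV :: 't set)" "continuous_on UNIV a"
    and ne: "feasible a b \<noteq> {}" and lop: "locally_polyhedral a b"
    and "0 \<le> M"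
    and far: "\<And>e D w. e \<in> extreme_points a b \<Longrightarrow> D \<in> supported_subsets a b e \<Longrightarrow>
                w \<in> convex hull (a ` D) \<Longrightarrow> 1 \<le> M * dual_norm N w"
  shows "dist_to_set (norm_dist N) x (feasible a b)
           \<le> ennreal M * dist_to_set dist b (mf_inverse (feasible a) x)"
proof -
  obtain y where y: "y \<in> feasible a b" and min: "\<And>f. f \<in> feasible a b \<Longrightarrow> N (x - y) \<le> N (x - f)"
    using nearest_point_exists[OF N closed_feasible ne] by blast
  have le: "N (x - y) \<le> M * dist b c" if c: "c \<in> mf_inverse (feasible a) x" for c
  proof (cases "x = y")
    case True
    then show ?thesis
      using \<open>0 \<le> M\<close> by (simp add: is_norm_eq_0[OF N, of 0, simplified])
  next
    case False
    then have pos: "N (x - y) > 0"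
      using is_norm_nonneg[OF N, of "x - y"] is_norm_eq_0[OF N, of "x - y"] by simp
    define m where "m = dist b c"
    have m: "a t \<bullet> x \<le> apply_bcontfun b t + m" for t
    proof -
      have "a t \<bullet> x \<le> apply_bcontfun c t"
        using c by (simp add: mf_inverse_def feasible_def)
      also have "\<dots> \<le> apply_bcontfun b t + m"
        using dist_bounded[of b t c] unfolding m_def dist_real_def by linarith
      finally show ?thesis .
    qed
    have "m > 0"
    proof (rule ccontr)
      assume "\<not> m > 0"
      then have "m = 0" by (simp add: m_def)
      then have "x \<in> feasible a b" using m by (simp add: feasible_def)
      then show False
        using min[of x] pos by (simp add: is_norm_eq_0[OF N, of 0, simplified])
    qed
    obtain u where u: "u \<noteq> 0" "u \<bullet> (x - y) = dual_norm N u * N (x - y)"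
        and umax: "\<And>f. f \<in> feasible a b \<Longrightarrow> u \<bullet> f \<le> u \<bullet> y"
      using nearest_point_normal[OF N convex_feasible y min pos] by blast
    obtain e where e: "e \<in> extreme_points a b" "u \<bullet> e = u \<bullet> y"
      using maximal_extreme_point_exists[OF lop y umax] by blast
    have ef: "e \<in> feasible a b"
      using e(1) by (auto simp: extreme_points_def extreme_point_of_def)
    have "u \<in> closure (convex_cone hull (a ` active_set a b e))"
      using normal_in_closure_active_cone[OF lop ef, of u] umax e(2)
      by (simp add: active_cone_def)
    \<comment> \<open>For active \<open>t\<close> the value \<open>a t \<bullet> e\<close> is
      \<open>b\<close> at \<open>t\<close>, which \<open>a t \<bullet> x\<close> exceeds by at most
      \<open>m\<close>.\<close>
    moreover have "k \<bullet> ((1 / m) *\<^sub>R (x - e)) \<le> 1" if "k \<in> a ` active_set a b e" for k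
      using that m \<open>m > 0\<close> by (auto simp: active_set_def inner_diff_right divide_le_eq diff_le_eq add.commute)
    moreover have "1 \<le> M * dual_norm N w"
      if q: "\<And>k. k \<in> a ` active_set a b e \<Longrightarrow> k \<bullet> q \<le> 1"
        and w: "w \<in> convex hull {k \<in> a ` active_set a b e. k \<bullet> q = 1}" for q w
    proof (rule far[OF e(1)])
      \<comment> \<open>The vector \<open>q\<close> itself exposes this index set.\<close>
      show "{t \<in> active_set a b e. a t \<bullet> q = 1} \<in> supported_subsets a b e"
        unfolding supported_subsets_def using q by (auto intro!: exI[of _ q] simp: order_less_le)
      have "{k \<in> a ` active_set a b e. k \<bullet> q = 1} = a ` {t \<in> active_set a b e. a t \<bullet> q = 1}"
        by auto
      then show "w \<in> convex hull (a ` {t \<in> active_set a b e. a t \<bullet> q = 1})"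
        using w by simp
    qed
    ultimately have "u \<bullet> ((1 / m) *\<^sub>R (x - e)) \<le> M * dual_norm N u"
      using inner_le_if_exposed_faces_far[OF is_norm_dual_norm[OF N] compact_active_image[OF T], of b e M
          "(1 / m) *\<^sub>R (x - e)" u] by blast
    then have "u \<bullet> (x - e) \<le> m * M * dual_norm N u"
      unfolding inner_scaleR_right using \<open>m > 0\<close> by (simp add: divide_le_eq mult_ac)
    also have "u \<bullet> (x - e) = dual_norm N u * N (x - y)"
      using u(2) e(2) by (simp add: inner_diff_right)
    finally have "dual_norm N u * N (x - y) \<le> dual_norm N u * (M * m)"
      by (simp add: mult_ac)
    moreover have "dual_norm N u > 0"
      using is_norm_eq_0[OF is_norm_dual_norm[OF N], of u] u(1) dual_norm_nonneg[OF N, of u] by simp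
    ultimately show ?thesis by (simp add: m_def)
  qed
  \<comment> \<open>Needed when \<open>M = 0\<close>: the product with an infinite distance would be
    0, so some \<open>c\<close> is required for \<open>le\<close> to give
    \<open>N (x - y) = 0\<close>.\<close>
  have ne': "mf_inverse (feasible a) x \<noteq> {}"
  proof -
    have "compact (range (\<lambda>t. a t \<bullet> x - apply_bcontfun b t))"
      by (intro compact_continuous_image T(1) continuous_intros T(2)) auto
    then obtain B where "B > 0" "\<And>t. \<bar>a t \<bullet> x - apply_bcontfun b t\<bar> \<le> B"
      using bounded_pos[of "range (\<lambda>t. a t \<bullet> x - apply_bcontfun b t)"] compact_imp_bounded
      by auto
    then show ?thesis
      using mf_inverse_near[OF T, of x b B] by (metis abs_le_D1 empty_iff less_imp_le)
  qed
  have "dist_to_set (norm_dist N) x (feasible a b) \<le> ennreal (N (x - y))"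
    unfolding dist_to_set_def norm_dist_def using y by (rule INF_lower)
  also have "\<dots> \<le> ennreal M * dist_to_set dist b (mf_inverse (feasible a) x)"
  proof (cases "M = 0")
    case True
    then show ?thesis using le ne' by (auto simp: ennreal_eq_0_iff)
  next
    case False
    then have "M > 0" using \<open>0 \<le> M\<close> by simp
    have "ennreal (N (x - y) / M) \<le> dist_to_set dist b (mf_inverse (feasible a) x)"
      unfolding dist_to_set_def
      using le \<open>M > 0\<close> by (intro INF_greatest ennreal_leI) (simp add: divide_le_eq mult.commute)
    then have "ennreal M * ennreal (N (x - y) / M)
        \<le> ennreal M * dist_to_set dist b (mf_inverse (feasible a) x)"
      by (rule mult_left_mono) simp
    then show ?thesis
      using \<open>M > 0\<close> is_norm_nonneg[OF N, of "x - y"] by (simp add: ennreal_mult[symmetric])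
  qed
  finally show ?thesis .
qed

section \<open>The two equalities\<close>

theorem theorem6:
  fixes a :: "'t::metric_space \<Rightarrow> real ^ 'n"
    and b :: "'t \<Rightarrow>\<^sub>C real"
    and N :: "real ^ 'n \<Rightarrow> real"
  assumes "is_norm N"
    and "compact (UNIV :: 't set)"
    and "continuous_on UNIV a"
    and "b \<in> mf_dom (feasible a)"
    and "locally_polyhedral a b"
  shows "Hof N (feasible a) b = (SUP x\<in>extreme_points a b. clm N (feasible a) b x) \<and>
    (SUP x\<in>extreme_points a b. clm N (feasible a) b x) =
      (SUP x\<in>extreme_points a b. SUP D\<in>supported_subsets a b x.
        inverse (dist_to_set (norm_dist (dual_norm N)) 0 (convex hull (a ` D))))"
proof -
  let ?inv = "\<lambda>D. inverse (dist_to_set (norm_dist (dual_norm N)) 0 (convex hull (a ` D)))"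
  let ?clm = "SUP x\<in>extreme_points a b. clm N (feasible a) b x"
  let ?sup = "SUP x\<in>extreme_points a b. SUP D\<in>supported_subsets a b x. ?inv D"
  note dual = is_norm_dual_norm[OF assms(1)]
  \<comment> \<open>Three inequalities close a cycle. For the first, a constant valid for all
    \<open>x\<close> is valid near \<open>e\<close>.\<close>
  have "?clm \<le> Hof N (feasible a) b"
  proof (rule SUP_least)
    fix e assume "e \<in> extreme_points a b"
    show "clm N (feasible a) b e \<le> Hof N (feasible a) b"
      unfolding clm_def Hof_def by (intro Inf_superset_mono) auto
  qed
  moreover have "?sup \<le> ?clm"
  proof (intro SUP_least)
    fix e D assume e: "e \<in> extreme_points a b" and D: "D \<in> supported_subsets a b e"
    then have "e \<in> feasible a b"
      by (auto simp: extreme_points_def extreme_point_of_def)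
    then have "?inv D \<le> clm N (feasible a) b e"
      unfolding clm_def
      by (intro Inf_greatest)
        (auto simp: inverse_dist_to_set_le_iff[OF dual] intro: clm_constant_lower_bound[OF assms(1-3) _ D])
    then show "?inv D \<le> ?clm"
      using e by (rule SUP_upper2[rotated])
  qed
  \<comment> \<open>An infinite supremum is trivial; a finite one is itself an admissible constant
    in \<open>Hof\<close>.\<close>
  moreover have "Hof N (feasible a) b \<le> ?sup"
  proof (cases ?sup rule: ennreal_cases)
    case (real M)
    have far: "1 \<le> M * dual_norm N w" if "e \<in> extreme_points a b" "D \<in> supported_subsets a b e"
      "w \<in> convex hull (a ` D)" for e D w
    proof -
      have "?inv D \<le> ?sup"
        using that(1,2) by (meson SUP_upper SUP_upper2)
      then show ?thesis
        using real that(3) inverse_dist_to_set_le_iff[OF dual, of M] by metis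
    qed
    have "feasible a b \<noteq> {}"
      using assms(4) by (simp add: mf_dom_def)
    from global_error_bound[OF assms(1-3) this assms(5) real(1) far] real show ?thesis
      unfolding Hof_def by (auto intro!: Inf_lower)
  next
    case top
    show ?thesis unfolding top by (rule top_greatest)
  qed
  ultimately show ?thesis by (meson order_antisym order_trans)
qed

end
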